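(* Let $G=(V,E)$ be a $3$-regular bipartite graph that contains no cycle of length four. Then the edge vs stable set matrix $M(G)$ has a fooling set of size $|E|$.
   Context: Graphs are finite and simple. The edge vs stable set matrix $M(G)$ of a graph $G$ is the $0/1$ matrix with a row for each edge $e$ of $G$, a column for each stable set $S$ of $G$ (edges are regarded as 2-element vertex sets), and entry $1$ in position $(e,S)$ if and only if $e \cap S = \varnothing$. For a matrix $M$, its support is $\{(i,j) : M_{ij}\neq 0\}$. A fooling set for $M$ is a set $F$ of entries in the support of $M$ such that $M_{i\ell}\cdot M_{kj}=0$ for all distinct $(i,j),(k,\ell)\in F$. *)

theory Defs
  imports Main
begin

definition simple_graph :: "'v set \<Rightarrow> 'v set set \<Rightarrow> bool" where
  "simple_graph V E \<longleftrightarrow> finite V \<and> (\<forall>e\<in>E. e \<subseteq> V \<and> card e = 2)"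

definition degree :: "'v set set \<Rightarrow> 'v \<Rightarrow> nat" where
  "degree E v = card {e \<in> E. v \<in> e}"

definition regular_graph :: "nat \<Rightarrow> 'v set \<Rightarrow> 'v set set \<Rightarrow> bool" where
  "regular_graph k V E \<longleftrightarrow> (\<forall>v\<in>V. degree E v = k)"

definition bipartite_graph :: "'v set \<Rightarrow> 'v set set \<Rightarrow> bool" where
  "bipartite_graph V E \<longleftrightarrow>
    (\<exists>A B. A \<union> B = V \<and> A \<inter> B = {} \<and> (\<forall>e\<in>E. \<exists>a\<in>A. \<exists>b\<in>B. e = {a, b}))"

text \<open>A cycle is given by its cyclic sequence of pairwise distinct vertices. It is a subgraph,
  not necessarily an induced one.\<close>

definition is_cycle :: "'v set set \<Rightarrow> 'v list \<Rightarrow> bool" where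
  "is_cycle E vs \<longleftrightarrow> length vs \<ge> 3 \<and> distinct vs \<and>
    (\<forall>i < length vs. {vs ! i, vs ! (Suc i mod length vs)} \<in> E)"

definition stable_sets :: "'v set \<Rightarrow> 'v set set \<Rightarrow> 'v set set" where
  "stable_sets V E = {S. S \<subseteq> V \<and> (\<forall>e\<in>E. \<not> e \<subseteq> S)}"

text \<open>A matrix with rows indexed by a set \<open>R\<close> and columns indexed by a set \<open>C\<close> is given by
  \<open>R\<close>, \<open>C\<close> and an entry function, of which only the values on \<open>R \<times> C\<close> matter.\<close>

definition support :: "'r set \<Rightarrow> 'c set \<Rightarrow> ('r \<Rightarrow> 'c \<Rightarrow> 'a::zero) \<Rightarrow> ('r \<times> 'c) set" where
  "support R C M = {(i, j). i \<in> R \<and> j \<in> C \<and> M i j \<noteq> 0}"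

definition fooling_set ::
    "'r set \<Rightarrow> 'c set \<Rightarrow> ('r \<Rightarrow> 'c \<Rightarrow> 'a::mult_zero) \<Rightarrow> ('r \<times> 'c) set \<Rightarrow> bool" where
  "fooling_set R C M F \<longleftrightarrow> F \<subseteq> support R C M \<and>
    (\<forall>(i, j)\<in>F. \<forall>(k, l)\<in>F. (i, j) \<noteq> (k, l) \<longrightarrow> M i l * M k j = 0)"

text \<open>Entries of the edge vs stable set matrix of \<open>(V, E)\<close>; its rows are indexed by \<open>E\<close> and its
  columns by \<open>stable_sets V E\<close>.\<close>

definition edge_stable_matrix :: "'v set \<Rightarrow> 'v set \<Rightarrow> int" where
  "edge_stable_matrix e S = (if e \<inter> S = {} then 1 else 0)"

end

theory Submission
  imports Defs
begin

text \<open>By Hall's theorem the edge set of \<open>G\<close> contains two disjoint perfect matchings \<open>f\<close> and \<open>g\<close>,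
  given as bijections from the colour class \<open>A\<close> to the colour class \<open>B\<close>. An edge \<open>ab\<close> with
  \<open>a \<in> A\<close>, \<open>b \<in> B\<close> is paired with the stable set \<open>A - {a}\<close> if it lies in the first matching, with
  \<open>B - {b}\<close> if it lies in the second one, and otherwise with \<open>f a\<close> together with all
  non-neighbours of \<open>f a\<close> in \<open>A\<close>. If two edges outside both matchings were disjoint from each
  other's stable sets, then their ends in \<open>A\<close> would be two common neighbours of their
  \<open>f\<close>-partners, which is a cycle of length four; the other cases are similar or immediate.\<close>

text \<open>Induction on \<open>I\<close>. If some nonempty proper subset is tight, it and its
  complement are matched separately, the complement avoiding the neighbours of the tight set.
  Otherwise every nonempty proper subset has slack, and one index can be matched
  arbitrarily.\<close>

lemma hall:
  fixes N :: "'i \<Rightarrow> 'b set"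
  assumes "finite I" and "\<And>i. i \<in> I \<Longrightarrow> finite (N i)"
    and "\<And>J. J \<subseteq> I \<Longrightarrow> card J \<le> card (\<Union>(N ` J))"
  shows "\<exists>f. inj_on f I \<and> (\<forall>i\<in>I. f i \<in> N i)"
  using assms
proof (induction I arbitrary: N rule: finite_psubset_induct)
  case (psubset I)
  show ?case
  proof (cases "\<exists>J. J \<subset> I \<and> J \<noteq> {} \<and> card J = card (\<Union>(N ` J))")
    case True
    then obtain J where J: "J \<subset> I" "J \<noteq> {}" "card J = card (\<Union>(N ` J))" by blast
    have "\<exists>f. inj_on f J \<and> (\<forall>i\<in>J. f i \<in> N i)"
      using J(1) psubset.prems by (intro psubset.IH) auto
    then obtain f where f: "inj_on f J" "\<forall>i\<in>J. f i \<in> N i" by blast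
    define N' where "N' j = N j - \<Union>(N ` J)" for j
    \<comment> \<open>Hall's condition for the union of \<open>K\<close> and \<open>J\<close>, less
      the equality for the tight set \<open>J\<close>, is Hall's condition for
      \<open>N'\<close>.\<close>
    have "card K \<le> card (\<Union>(N' ` K))" if K: "K \<subseteq> I - J" for K
    proof -
      have KJ: "K \<union> J \<subseteq> I" using K J(1) by blast
      have "card K + card J = card (K \<union> J)"
        using K J(1) psubset.hyps by (subst card_Un_disjoint) (auto intro: finite_subset)
      also have "\<dots> \<le> card (\<Union>(N ` (K \<union> J)))" by (rule psubset.prems(2)[OF KJ])
      also have "\<Union>(N ` (K \<union> J)) = \<Union>(N' ` K) \<union> \<Union>(N ` J)" by (auto simp: N'_def)
      also have "card \<dots> \<le> card (\<Union>(N' ` K)) + card (\<Union>(N ` J))" by (rule card_Un_le)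
      finally show ?thesis using J(3) by simp
    qed
    moreover have "I - J \<subset> I" using J by blast
    ultimately have "\<exists>g. inj_on g (I - J) \<and> (\<forall>i\<in>I - J. g i \<in> N' i)"
      using psubset.prems(1) by (intro psubset.IH) (auto simp: N'_def)
    then obtain g where g: "inj_on g (I - J)" "\<forall>i\<in>I - J. g i \<in> N' i" by blast
    define h where "h i = (if i \<in> J then f i else g i)" for i
    have "f x \<noteq> g y" if "x \<in> J" "y \<in> I - J" for x y
      using that f(2) g(2) by (fastforce simp: N'_def)
    then have "inj_on h I"
      using f(1) g(1) by (auto simp: inj_on_def h_def) metis+
    moreover have "\<forall>i\<in>I. h i \<in> N i" using f g by (auto simp: h_def N'_def)
    ultimately show ?thesis by blast
  next
    case False
    then have strict: "card J < card (\<Union>(N ` J))" if "J \<subset> I" "J \<noteq> {}" for J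
      using that psubset.prems(2)[of J] by (metis le_neq_implies_less psubset_imp_subset)
    show ?thesis
    proof (cases "I = {}")
      case False
      then obtain i where i: "i \<in> I" by blast
      have "card {i} \<le> card (N i)" using psubset.prems(2)[of "{i}"] i by simp
      then obtain y where y: "y \<in> N i" by fastforce
      \<comment> \<open>Deleting \<open>y\<close> costs at most one neighbour, which the strict
        inequality for \<open>K\<close> pays for.\<close>
      have "card K \<le> card (\<Union>j\<in>K. N j - {y})" if K: "K \<subseteq> I - {i}" for K
      proof (cases "K = {}")
        case False
        then have "card K < card (\<Union>(N ` K))" using K i by (intro strict) auto
        moreover have "(\<Union>j\<in>K. N j - {y}) = \<Union>(N ` K) - {y}" by blast
        ultimately show ?thesis by (auto simp: card_Diff_singleton_if)
      qed simp
      moreover have "I - {i} \<subset> I" using i by blast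
      ultimately have "\<exists>f. inj_on f (I - {i}) \<and> (\<forall>j\<in>I - {i}. f j \<in> N j - {y})"
        using psubset.prems(1) by (intro psubset.IH) auto
      then obtain f where f: "inj_on f (I - {i})" "\<forall>j\<in>I - {i}. f j \<in> N j - {y}" by blast
      have "inj_on (f(i := y)) I" using f by (fastforce simp: inj_on_def)
      moreover have "\<forall>j\<in>I. (f(i := y)) j \<in> N j" using f y by auto
      ultimately show ?thesis by blast
    qed simp
  qed
qed

text \<open>Double counting: the \<open>k * card J\<close> pairs leaving \<open>J\<close> all end
  among its neighbours, each of which lies in only \<open>k\<close> pairs. This gives Hall's
  condition. Counting all of \<open>R\<close> from both sides gives \<open>card A = card B\<close>,
  so the injection is onto.\<close>

lemma regular_bipartite_perfect_matching:
  fixes R :: "('a \<times> 'b) set"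
  assumes fin: "finite A" "finite B" and R: "R \<subseteq> A \<times> B" and k: "0 < k"
    and degA: "\<And>a. a \<in> A \<Longrightarrow> card {b. (a, b) \<in> R} = k"
    and degB: "\<And>b. b \<in> B \<Longrightarrow> card {a. (a, b) \<in> R} = k"
  shows "\<exists>f. bij_betw f A B \<and> (\<forall>a\<in>A. (a, f a) \<in> R)"
proof -
  have finA: "finite {b. (a, b) \<in> R}" for a
    by (rule finite_subset[OF _ fin(2)]) (use R in auto)
  have finB: "finite {a. (a, b) \<in> R}" for b
    by (rule finite_subset[OF _ fin(1)]) (use R in auto)
  have countA: "card (SIGMA a:J. {b. (a, b) \<in> R}) = k * card J" if "J \<subseteq> A" for J
  proof -
    have "card (SIGMA a:J. {b. (a, b) \<in> R}) = (\<Sum>a\<in>J. card {b. (a, b) \<in> R})"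
      using finite_subset[OF that fin(1)] finA by (intro card_SigmaI) auto
    also have "\<dots> = (\<Sum>a\<in>J. k)" using that degA by (intro sum.cong) auto
    finally show ?thesis by simp
  qed
  have countB: "card (SIGMA b:J. {a. (a, b) \<in> R}) = k * card J" if "J \<subseteq> B" for J
  proof -
    have "card (SIGMA b:J. {a. (a, b) \<in> R}) = (\<Sum>b\<in>J. card {a. (a, b) \<in> R})"
      using finite_subset[OF that fin(2)] finB by (intro card_SigmaI) auto
    also have "\<dots> = (\<Sum>b\<in>J. k)" using that degB by (intro sum.cong) auto
    finally show ?thesis by simp
  qed
  have "card J \<le> card (\<Union>a\<in>J. {b. (a, b) \<in> R})" if J: "J \<subseteq> A" for J
  proof -
    let ?N = "\<Union>a\<in>J. {b. (a, b) \<in> R}"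
    have N: "?N \<subseteq> B" using R by blast
    have "prod.swap ` (SIGMA a:J. {b. (a, b) \<in> R}) \<subseteq> (SIGMA b:?N. {a. (a, b) \<in> R})"
      by auto
    moreover have "finite (SIGMA b:?N. {a. (a, b) \<in> R})"
      using finite_subset[OF N fin(2)] finB by (intro finite_SigmaI) auto
    ultimately have "card (prod.swap ` (SIGMA a:J. {b. (a, b) \<in> R}))
        \<le> card (SIGMA b:?N. {a. (a, b) \<in> R})"
      by (intro card_mono)
    then have "card (SIGMA a:J. {b. (a, b) \<in> R}) \<le> card (SIGMA b:?N. {a. (a, b) \<in> R})"
      by (simp only: card_image[OF inj_swap])
    then show ?thesis using countA[OF J] countB[OF N] k by simp
  qed
  then obtain f where f: "inj_on f A" "\<forall>a\<in>A. (a, f a) \<in> R"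
    using hall[of A "\<lambda>a. {b. (a, b) \<in> R}"] fin finA by auto
  have swap: "(SIGMA b:B. {a. (a, b) \<in> R}) = prod.swap ` (SIGMA a:A. {b. (a, b) \<in> R})"
    using R by auto
  have "k * card A = k * card B"
    unfolding countA[OF order_refl, symmetric] countB[OF order_refl, symmetric] swap
    by (rule card_image[OF inj_swap, symmetric])
  then have "card A = card B" using k by simp
  moreover have "f ` A \<subseteq> B" using f(2) R by blast
  ultimately have "f ` A = B"
    using card_image[OF f(1)] fin by (simp add: card_subset_eq)
  then show ?thesis using f by (auto simp: bij_betw_def)
qed

text \<open>Deleting a perfect matching from a 3-regular relation leaves a 2-regular one, which
  again has a perfect matching.\<close>

lemma cubic_bipartite_disjoint_matchings:
  fixes R :: "('a \<times> 'b) set"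
  assumes fin: "finite A" "finite B" and R: "R \<subseteq> A \<times> B"
    and degA: "\<And>a. a \<in> A \<Longrightarrow> card {b. (a, b) \<in> R} = 3"
    and degB: "\<And>b. b \<in> B \<Longrightarrow> card {a. (a, b) \<in> R} = 3"
  obtains f g where "bij_betw f A B" "\<And>a. a \<in> A \<Longrightarrow> (a, f a) \<in> R"
    "bij_betw g A B" "\<And>a. a \<in> A \<Longrightarrow> (a, g a) \<in> R" "\<And>a. a \<in> A \<Longrightarrow> f a \<noteq> g a"
proof -
  obtain f where f: "bij_betw f A B" "\<forall>a\<in>A. (a, f a) \<in> R"
    using regular_bipartite_perfect_matching[OF fin R _ degA degB] by auto
  define R' where "R' = {(a, b) \<in> R. b \<noteq> f a}"
  have "card {b. (a, b) \<in> R'} = 2" if "a \<in> A" for a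
  proof -
    have "{b. (a, b) \<in> R'} = {b. (a, b) \<in> R} - {f a}" by (auto simp: R'_def)
    then show ?thesis using f(2) that degA[OF that] by (simp add: card_Diff_singleton)
  qed
  moreover have "card {a. (a, b) \<in> R'} = 2" if b: "b \<in> B" for b
  proof -
    obtain c where c: "c \<in> A" "f c = b" using f(1) b by (auto simp: bij_betw_def)
    \<comment> \<open>As \<open>f\<close> is injective, \<open>b\<close> loses exactly one
      neighbour, its preimage \<open>c\<close>.\<close>
    have "b = f x \<longleftrightarrow> x = c" if "x \<in> A" for x
      using that c f(1) by (auto simp: bij_betw_def inj_on_def)
    then have "{a. (a, b) \<in> R'} = {a. (a, b) \<in> R} - {c}" using R by (auto simp: R'_def)
    then show ?thesis using f(2) c degB[OF b] by (auto simp: card_Diff_singleton)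
  qed
  moreover have "R' \<subseteq> A \<times> B" using R by (auto simp: R'_def)
  ultimately obtain g where g: "bij_betw g A B" "\<forall>a\<in>A. (a, g a) \<in> R'"
    using regular_bipartite_perfect_matching[OF fin, of R' 2] by auto
  show thesis
    using f g by (intro that[of f g]) (fastforce simp: R'_def)+
qed

lemma degree_eq_card_neighbours:
  assumes "\<And>e. e \<in> E \<Longrightarrow> v \<in> e \<Longrightarrow> \<exists>w. e = {v, w}"
  shows "degree E v = card {w. {v, w} \<in> E}"
proof -
  have "{e \<in> E. v \<in> e} = (\<lambda>w. {v, w}) ` {w. {v, w} \<in> E}" using assms by blast
  moreover have "inj_on (\<lambda>w. {v, w}) {w. {v, w} \<in> E}" by (auto simp: inj_on_def doubleton_eq_iff)
  ultimately show ?thesis unfolding degree_def by (simp add: card_image)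
qed

theorem theorem4:
  fixes V :: "'v set" and E :: "'v set set"
  assumes "simple_graph V E"
    and "regular_graph 3 V E"
    and "bipartite_graph V E"
    and "\<not> (\<exists>vs. is_cycle E vs \<and> length vs = 4)"
  shows "\<exists>F. fooling_set E (stable_sets V E) edge_stable_matrix F \<and> card F = card E"
proof -
  obtain A B where AB: "A \<union> B = V" "A \<inter> B = {}" "\<forall>e\<in>E. \<exists>a\<in>A. \<exists>b\<in>B. e = {a, b}"
    using assms(3) by (auto simp: bipartite_graph_def)
  have fin: "finite A" "finite B" using AB(1) assms(1) by (auto simp: simple_graph_def)
  \<comment> \<open>Edges as ordered pairs, so that the ends in \<open>A\<close> and in
    \<open>B\<close> can be told apart; \<open>E\<close> and \<open>inj\<close> below show that this
    is a bijective encoding.\<close>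
  define R where "R = {(a, b). a \<in> A \<and> b \<in> B \<and> {a, b} \<in> E}"
  have R: "R \<subseteq> A \<times> B" by (auto simp: R_def)
  have E: "E = (\<lambda>(a, b). {a, b}) ` R" using AB(3) by (fastforce simp: R_def)
  have inj: "inj_on (\<lambda>(a, b). {a, b}) R"
    using AB(2) R by (fastforce simp: inj_on_def doubleton_eq_iff)
  have deg: "card {w. {v, w} \<in> E} = 3" if "v \<in> V" for v
  proof -
    have "degree E v = card {w. {v, w} \<in> E}"
      using AB(3) by (intro degree_eq_card_neighbours) (metis insert_commute insert_iff singletonD)
    then show ?thesis using that assms(2) by (simp add: regular_graph_def)
  qed
  have degA: "card {b. (a, b) \<in> R} = 3" if "a \<in> A" for a
  proof -
    have "{b. (a, b) \<in> R} = {w. {a, w} \<in> E}"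
      using that AB(2,3) by (fastforce simp: R_def doubleton_eq_iff)
    then show ?thesis using deg that AB(1) by auto
  qed
  have degB: "card {a. (a, b) \<in> R} = 3" if "b \<in> B" for b
  proof -
    have "{a. (a, b) \<in> R} = {w. {b, w} \<in> E}"
      using that AB(2,3) by (fastforce simp: R_def doubleton_eq_iff insert_commute)
    then show ?thesis using deg that AB(1) by auto
  qed
  obtain f g where f: "bij_betw f A B" "\<And>a. a \<in> A \<Longrightarrow> (a, f a) \<in> R"
    and g: "bij_betw g A B" "\<And>a. a \<in> A \<Longrightarrow> (a, g a) \<in> R" and fg: "\<And>a. a \<in> A \<Longrightarrow> f a \<noteq> g a"
    using cubic_bipartite_disjoint_matchings[OF fin R degA degB] by blast
  have C4: "a = c \<or> b = d" if "(a, b) \<in> R" "(a, d) \<in> R" "(c, b) \<in> R" "(c, d) \<in> R" for a b c d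
  proof (rule ccontr)
    assume "\<not> (a = c \<or> b = d)"
    moreover have "a \<noteq> b" "a \<noteq> d" "c \<noteq> b" "c \<noteq> d" using that R AB(2) by auto
    ultimately have "is_cycle E [a, b, c, d]"
      using that by (auto simp: is_cycle_def R_def less_Suc_eq insert_commute)
    then show False using assms(4) by fastforce
  qed
  have only: "b \<in> {f a, g a, d}" if "(a, b) \<in> R" "(a, d) \<in> R" "d \<notin> {f a, g a}" for a b d
  proof (rule ccontr)
    assume b: "b \<notin> {f a, g a, d}"
    have a: "a \<in> A" using that R by auto
    have "{f a, g a, b, d} \<subseteq> {w. (a, w) \<in> R}" using that f(2)[OF a] g(2)[OF a] by auto
    \<comment> \<open>An infinite set has \<open>card\<close> equal to 0, so degree 3 forces
      finiteness.\<close>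
    moreover have "finite {w. (a, w) \<in> R}" using degA[OF a] card.infinite by fastforce
    ultimately have "card {f a, g a, b, d} \<le> 3" using card_mono degA[OF a] by metis
    then show False using b that(3) fg[OF a] by (auto simp: card_insert_if split: if_splits)
  qed
  define S where "S = (\<lambda>a b. if b = f a then A - {a} else if b = g a then B - {b}
    else insert (f a) {x \<in> A. (x, f a) \<notin> R})"
  have stable: "S a b \<in> stable_sets V E" if "(a, b) \<in> R" for a b
  proof -
    have "a \<in> A" "f a \<in> B" using that R f(2) by auto
    \<comment> \<open>The first two kinds of set lie inside one colour class. In the third,
      \<open>f a\<close> is the only vertex of \<open>B\<close>, and its neighbours are left
      out.\<close>
    have "\<not> {x, y} \<subseteq> S a b" if "(x, y) \<in> R" for x y
      using that R AB(2) \<open>a \<in> A\<close> \<open>f a \<in> B\<close> by (auto simp: S_def split: if_splits)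
    then have "\<not> e \<subseteq> S a b" if "e \<in> E" for e using that unfolding E by auto
    moreover have "S a b \<subseteq> V"
      using AB(1) \<open>f a \<in> B\<close> by (auto simp: S_def)
    ultimately show ?thesis by (simp add: stable_sets_def)
  qed
  have self: "{a, b} \<inter> S a b = {}" if "(a, b) \<in> R" for a b
  proof -
    have "a \<in> A" "b \<in> B" "(a, f a) \<in> R" using that R f(2) by auto
    moreover have "a \<notin> B" "b \<notin> A" "a \<noteq> f a" using calculation R AB(2) by auto
    ultimately show ?thesis by (auto simp: S_def)
  qed
  \<comment> \<open>Within \<open>A\<close> the set \<open>A - {a}\<close> misses only
    \<open>a\<close>, and within \<open>B\<close> the set \<open>B - {b}\<close> misses only
    \<open>b\<close>. The third kind misses, in \<open>A\<close>, just the neighbours of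
    \<open>f a\<close>, and in \<open>B\<close> everything but \<open>f a\<close>.\<close>
  have miss: "(b = f a \<longrightarrow> c = a) \<and> (b \<noteq> f a \<and> b = g a \<longrightarrow> d = b)
      \<and> (b \<noteq> f a \<and> b \<noteq> g a \<longrightarrow> (c, f a) \<in> R \<and> d \<noteq> f a)"
    if "(a, b) \<in> R" "(c, d) \<in> R" "{c, d} \<inter> S a b = {}" for a b c d
    using that R by (auto simp: S_def split: if_splits)
  have fool: "(a, b) = (c, d)"
    if "(a, b) \<in> R" "(c, d) \<in> R" "{c, d} \<inter> S a b = {}" "{a, b} \<inter> S c d = {}" for a b c d
  proof -
    have in_A: "a \<in> A" "c \<in> A" using that R by auto
    have inj_f: "a = c" if "f a = f c" using f(1) that in_A by (auto simp: bij_betw_def inj_on_def)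
    have inj_g: "a = c" if "g a = g c" using g(1) that in_A by (auto simp: bij_betw_def inj_on_def)
    note m = miss[OF that(1-3)] miss[OF that(2,1,4)]
    note ff = f(2)[OF in_A(1)] f(2)[OF in_A(2)]
    consider "b = f a" | "d = f c" | "b = g a" "d = g c" | "b = g a" "d \<noteq> f c" "d \<noteq> g c"
      | "b \<noteq> f a" "b \<noteq> g a" "d = g c" | "b \<noteq> f a" "b \<noteq> g a" "d \<noteq> f c" "d \<noteq> g c"
      by metis
    then show ?thesis
    proof cases
      case 1
      \<comment> \<open>Here \<open>c = a\<close>. If \<open>d = g c\<close>, the set of the second
        edge forces \<open>b = d\<close>; if \<open>d\<close> is in neither matching, it forces
        \<open>b \<noteq> f c\<close>, which is absurd.\<close>
      then show ?thesis using m fg[OF in_A(1)] by metis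
    next
      case 2
      then show ?thesis using m fg[OF in_A(2)] by metis
    next
      case 3
      then show ?thesis using m inj_g fg[OF in_A(1)] by metis
    next
      case 4
      then have "d = b" "(a, f c) \<in> R" "b \<noteq> f c" using m fg[OF in_A(1)] by metis+
      \<comment> \<open>The distinct vertices \<open>b\<close> and \<open>f c\<close> are common
        neighbours of \<open>a\<close> and \<open>c\<close>, so \<open>a = c\<close>.\<close>
      then show ?thesis using C4[of a b "f c" c] that(1,2) ff by blast
    next
      case 5
      then have "d = b" "(c, f a) \<in> R" "d \<noteq> f a" using m fg[OF in_A(2)] by metis+
      then show ?thesis using C4[of a b "f a" c] that(1,2) ff by blast
    next
      case 6
      then have "(c, f a) \<in> R" "(a, f c) \<in> R" using m by blast+
      then have "a = c" using C4[of a "f a" "f c" c] inj_f ff by blast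
      \<comment> \<open>Both \<open>b\<close> and \<open>d\<close> are now the single neighbour of
        \<open>a\<close> outside the two matchings.\<close>
      then show ?thesis using only[of a d b] that(1,2) 6 by auto
    qed
  qed
  define F where "F = (\<lambda>(a, b). ({a, b}, S a b)) ` R"
  \<comment> \<open>The row alone determines the pair, so \<open>F\<close> has one entry for each
    edge.\<close>
  have "inj_on (\<lambda>(a, b). ({a, b}, S a b)) R" using inj by (fastforce simp: inj_on_def)
  then have "card F = card E" unfolding F_def E using inj by (simp add: card_image)
  moreover have "F \<subseteq> support E (stable_sets V E) edge_stable_matrix"
    using stable self by (auto simp: F_def support_def edge_stable_matrix_def R_def)
  moreover have "edge_stable_matrix {a, b} (S c d) * edge_stable_matrix {c, d} (S a b) = 0"
    if "(a, b) \<in> R" "(c, d) \<in> R" "(a, b) \<noteq> (c, d)" for a b c d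
    using fool[OF that(1,2)] that(3) by (auto simp: edge_stable_matrix_def)
  ultimately have "fooling_set E (stable_sets V E) edge_stable_matrix F"
    unfolding fooling_set_def F_def by fastforce
  then show ?thesis using \<open>card F = card E\<close> by blast
qed

end
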